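(* Let $\{x_t\}$ be a (strictly) stationary $\mathbb{R}^n$-valued process, indexed by the grid $t\in\Delta\mathbb{Z}$ with $\Delta>0$, with stationary (one-time marginal) law $\pi$. For $\psi,\varphi\in L^2(\pi)$ (real valued) and $h\in\Delta\mathbb{Z}$, $h\geq 0$, define the feature circulation $$Q^{\psi\varphi}_h:=\tfrac12\Bigl(\mathbb{E}[\psi(x_{t+h})\varphi(x_t)]-\mathbb{E}[\varphi(x_{t+h})\psi(x_t)]\Bigr).$$ (i) If $\{x_t\}$ is reversible, then $Q^{\psi\varphi}_h=0$ for every $h$ and every pair $\psi,\varphi\in L^2(\pi)$. (ii) If in addition to stationarity $\{x_t\}$ is Markov, the converse holds: if $Q^{\psi\varphi}_\Delta=0$ for all $\psi,\varphi$ in a complete system of $L^2(\pi)$, then the process $\{x_t\}$ is reversible.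
   Context: A stationary process is reversible if $\{x_t\}$ and $\{x_{-t}\}$ have the same law. A complete system of $L^2(\pi)$ is a subset whose linear span is dense in $L^2(\pi)$. *)

theory Defs
  imports "HOL-Probability.Probability"
begin

definition time_grid :: "real \<Rightarrow> real set" where
  "time_grid \<Delta> = range (\<lambda>k::int. \<Delta> * of_int k)"

definition is_process :: "'w measure \<Rightarrow> real set \<Rightarrow> (real \<Rightarrow> 'w \<Rightarrow> 'b::topological_space) \<Rightarrow> bool" where
  "is_process M T X \<longleftrightarrow> (\<forall>t\<in>T. X t \<in> borel_measurable M)"

definition process_law ::
  "'w measure \<Rightarrow> real set \<Rightarrow> (real \<Rightarrow> 'w \<Rightarrow> 'b::topological_space) \<Rightarrow> (real \<Rightarrow> 'b) measure" where
  "process_law M T X = distr M (\<Pi>\<^sub>M t\<in>T. borel) (\<lambda>\<omega>. \<lambda>t\<in>T. X t \<omega>)"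

definition strictly_stationary ::
  "'w measure \<Rightarrow> real set \<Rightarrow> (real \<Rightarrow> 'w \<Rightarrow> 'b::topological_space) \<Rightarrow> bool" where
  "strictly_stationary M T X \<longleftrightarrow>
     (\<forall>s\<in>T. process_law M T (\<lambda>t. X (t + s)) = process_law M T X)"

definition reversible ::
  "'w measure \<Rightarrow> real set \<Rightarrow> (real \<Rightarrow> 'w \<Rightarrow> 'b::topological_space) \<Rightarrow> bool" where
  "reversible M T X \<longleftrightarrow> process_law M T (\<lambda>t. X (- t)) = process_law M T X"

definition generated_algebra ::
  "'w measure \<Rightarrow> real set \<Rightarrow> (real \<Rightarrow> 'w \<Rightarrow> 'b::topological_space) \<Rightarrow> 'w measure" where
  "generated_algebra M S X =
     sigma (space M) (\<Union>s\<in>S. {X s -` A \<inter> space M | A. A \<in> sets borel})"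

definition markov_process ::
  "'w measure \<Rightarrow> real set \<Rightarrow> (real \<Rightarrow> 'w \<Rightarrow> 'b::topological_space) \<Rightarrow> bool" where
  "markov_process M T X \<longleftrightarrow>
     (\<forall>s\<in>T. \<forall>t\<in>T. s \<le> t \<longrightarrow> (\<forall>A\<in>sets borel. AE \<omega> in M.
        real_cond_exp M (generated_algebra M {r\<in>T. r \<le> s} X) (\<lambda>\<omega>. indicator A (X t \<omega>)) \<omega>
      = real_cond_exp M (generated_algebra M {s} X) (\<lambda>\<omega>. indicator A (X t \<omega>)) \<omega>))"

text \<open>Square-integrable functions are kept as representatives rather than as classes modulo
  almost-everywhere equality, so the norm below is only a seminorm.\<close>

definition L2_space :: "'b measure \<Rightarrow> ('b \<Rightarrow> real) set" where
  "L2_space \<pi> = {f \<in> borel_measurable \<pi>. integrable \<pi> (\<lambda>x. (f x)\<^sup>2)}"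

definition L2_norm :: "'b measure \<Rightarrow> ('b \<Rightarrow> real) \<Rightarrow> real" where
  "L2_norm \<pi> f = sqrt (\<integral>x. (f x)\<^sup>2 \<partial>\<pi>)"

definition linear_span :: "('b \<Rightarrow> real) set \<Rightarrow> ('b \<Rightarrow> real) set" where
  "linear_span S = {\<lambda>x. \<Sum>g\<in>F. c g * g x | F c. finite F \<and> F \<subseteq> S}"

definition complete_system :: "'b measure \<Rightarrow> ('b \<Rightarrow> real) set \<Rightarrow> bool" where
  "complete_system \<pi> S \<longleftrightarrow> S \<subseteq> L2_space \<pi> \<and>
     (\<forall>f\<in>L2_space \<pi>. \<forall>\<epsilon>>0. \<exists>g\<in>linear_span S. L2_norm \<pi> (\<lambda>x. f x - g x) < \<epsilon>)"

text \<open>For a stationary process the value does not depend on the base time \<open>t\<close>.\<close>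

definition feature_circulation ::
  "'w measure \<Rightarrow> (real \<Rightarrow> 'w \<Rightarrow> 'b) \<Rightarrow> real \<Rightarrow> real \<Rightarrow> ('b \<Rightarrow> real) \<Rightarrow> ('b \<Rightarrow> real) \<Rightarrow> real" where
  "feature_circulation M X t h \<psi> \<phi> =
     1/2 * ((\<integral>\<omega>. \<psi> (X (t + h) \<omega>) * \<phi> (X t \<omega>) \<partial>M) - (\<integral>\<omega>. \<phi> (X (t + h) \<omega>) * \<psi> (X t \<omega>) \<partial>M))"

end

theory Submission
  imports Defs
begin

text \<open>If the process is reversible, stationarity makes the pair \<open>(X t, X (t + h))\<close> exchangeable, so
  every circulation vanishes. Conversely, the circulation is bilinear and continuous for the \<open>L\<^sup>2\<close>
  seminorm, so vanishing on a complete system extends to indicators, and the law of two successive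
  states is symmetric. The transition operator \<open>P\<close> is then self-adjoint. By the Markov property the
  probability of a path through \<open>A\<^sub>0, \<dots>, A\<^sub>n\<close> is \<open>\<integral> A\<^sub>0 P A\<^sub>1 P \<dots> P A\<^sub>n d\<pi>\<close> (a set
  standing for multiplication by its indicator), and taking adjoints reverses the word, so the path
  and its reversal have the same probability.\<close>

section \<open>Extending the Markov property to nonnegative functions\<close>

text \<open>The derivative is a version of the conditional expectation of \<open>h\<close> given
  \<open>Y\<close>, read as a function on the state space. It exists because a null set of the law
  of \<open>Y\<close> pulls back to a null event, on which any weight \<open>h\<close> integrates to
  zero; the base law is finite, so \<open>h\<close> may have infinite integral.\<close>

lemma RN_deriv_distr_nn_integral:
  assumes "prob_space M" and Y [measurable]: "Y \<in> measurable M N"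
    and h [measurable]: "h \<in> borel_measurable M" and g [measurable]: "g \<in> borel_measurable N"
  shows "(\<integral>\<^sup>+x. g x * RN_deriv (distr M N Y) (distr (density M h) N Y) x \<partial>distr M N Y)
       = (\<integral>\<^sup>+\<omega>. g (Y \<omega>) * h \<omega> \<partial>M)"
proof -
  interpret prob_space M by fact
  interpret D: prob_space "distr M N Y" by (rule prob_space_distr) fact
  have ac: "absolutely_continuous (distr M N Y) (distr (density M h) N Y)"
    unfolding absolutely_continuous_def
  proof
    fix A assume A: "A \<in> null_sets (distr M N Y)"
    then have [measurable]: "A \<in> sets N" by auto
    have "AE \<omega> in M. Y \<omega> \<notin> A" using AE_not_in[OF A] by (simp add: AE_distr_iff)
    then have "emeasure (density M h) (Y -` A \<inter> space M) = 0"
      by (subst emeasure_density) (auto simp: nn_integral_0_iff_AE)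
    then show "A \<in> null_sets (distr (density M h) N Y)"
      by (simp add: null_sets_def emeasure_distr)
  qed
  have "(\<integral>\<^sup>+x. g x * RN_deriv (distr M N Y) (distr (density M h) N Y) x \<partial>distr M N Y)
      = integral\<^sup>N (distr (density M h) N Y) g"
    using D.RN_deriv_nn_integral[OF ac, of g] by (simp add: mult.commute)
  also have "\<dots> = (\<integral>\<^sup>+\<omega>. g (Y \<omega>) * h \<omega> \<partial>M)"
    by (simp add: nn_integral_distr nn_integral_density mult.commute)
  finally show ?thesis .
qed

text \<open>The Markov property, given only for indicators of the next state, extends to an arbitrary
  function \<open>f\<close> because both sides below are measures in the next state: the event \<open>C\<close> may be
  traded for its conditional probability \<open>Z\<close> given the present.\<close>

lemma markov_nn_integral:
  fixes M :: "'w measure" and N :: "'b measure"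
  assumes "prob_space M" and sub: "subalgebra M F"
    and U [measurable]: "U \<in> measurable M N" and V [measurable]: "V \<in> measurable M N"
    and markov: "\<And>A. A \<in> sets N \<Longrightarrow> AE \<omega> in M.
      real_cond_exp M F (\<lambda>\<omega>. indicator A (V \<omega>)) \<omega>
    = real_cond_exp M (vimage_algebra (space M) U N) (\<lambda>\<omega>. indicator A (V \<omega>)) \<omega>"
    and C: "C \<in> sets F"
    and f [measurable]: "f \<in> borel_measurable N" and p [measurable]: "p \<in> borel_measurable N"
    and p_eq: "\<And>D. D \<in> sets N \<Longrightarrow> (\<integral>\<^sup>+\<omega>. indicator D (U \<omega>) * f (V \<omega>) \<partial>M)
                                   = (\<integral>\<^sup>+\<omega>. indicator D (U \<omega>) * p (U \<omega>) \<partial>M)"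
  shows "(\<integral>\<^sup>+\<omega>. indicator C \<omega> * f (V \<omega>) \<partial>M) = (\<integral>\<^sup>+\<omega>. indicator C \<omega> * p (U \<omega>) \<partial>M)"
proof -
  interpret prob_space M by fact
  define G where "G = vimage_algebra (space M) U N"
  have UG: "U \<in> measurable G N"
    unfolding G_def by (rule measurable_vimage_algebra1) (use measurable_space[OF U] in auto)
  have setsG: "sets G = {U -` A \<inter> space M | A. A \<in> sets N}"
    unfolding G_def by (rule sets_vimage_algebra2) (use measurable_space[OF U] in auto)
  have subG: "subalgebra M G"
    unfolding subalgebra_def setsG by (auto simp: G_def)
  interpret F: finite_measure_subalgebra M F
    by unfold_locales (rule sub)
  interpret G: finite_measure_subalgebra M G
    by unfold_locales (rule subG)
  have C' [measurable]: "C \<in> sets M" using C sub by (auto simp: subalgebra_def)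
  note C [measurable]
  define Z where "Z = real_cond_exp M G (indicator C)"
  have ZG [measurable]: "Z \<in> borel_measurable G" unfolding Z_def by simp
  have ZM [measurable]: "Z \<in> borel_measurable M" unfolding Z_def by simp
  have Z0: "AE \<omega> in M. 0 \<le> Z \<omega>" unfolding Z_def by (rule G.real_cond_exp_pos) auto
  have Zint: "integrable M Z" unfolding Z_def
    by (rule G.real_cond_exp_int) (auto intro: integrable_real_indicator simp: less_top[symmetric])
  have ind: "(\<integral>\<^sup>+\<omega>. indicator C \<omega> * indicator A (V \<omega>) \<partial>M)
           = (\<integral>\<^sup>+\<omega>. ennreal (Z \<omega>) * indicator A (V \<omega>) \<partial>M)" if [measurable]: "A \<in> sets N" for A
  proof -
    let ?h = "\<lambda>\<omega>. indicator A (V \<omega>) :: real"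
    have int1: "integrable M (\<lambda>\<omega>. indicator C \<omega> * ?h \<omega>)"
      by (rule integrable_const_bound[where B=1]) (auto simp: indicator_def)
    have int2: "integrable M (\<lambda>\<omega>. Z \<omega> * ?h \<omega>)"
      by (rule Bochner_Integration.integrable_bound[OF Zint]) (auto simp: indicator_def)
    have int3: "integrable M (real_cond_exp M G ?h)"
      by (rule G.real_cond_exp_int, rule integrable_const_bound[where B=1]) (auto simp: indicator_def)
    have int4: "integrable M (\<lambda>\<omega>. real_cond_exp M G ?h \<omega> * indicator C \<omega>)"
      by (rule Bochner_Integration.integrable_bound[OF int3]) (auto simp: indicator_def)
    \<comment> \<open>Since \<open>C\<close> lies in \<open>F\<close>, \<open>?h\<close> may be
      replaced by its projection onto \<open>F\<close>, which by the Markov property is the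
      projection onto \<open>G\<close>. Self-adjointness of that projection then turns
      \<open>C\<close> into \<open>Z\<close> and restores \<open>?h\<close>.\<close>
    have "(\<integral>\<omega>. indicator C \<omega> * ?h \<omega> \<partial>M) = (\<integral>\<omega>. indicator C \<omega> * real_cond_exp M F ?h \<omega> \<partial>M)"
      by (rule F.real_cond_exp_intg(2)[symmetric, OF int1]) auto
    also have "\<dots> = (\<integral>\<omega>. real_cond_exp M G ?h \<omega> * indicator C \<omega> \<partial>M)"
      using markov[OF that] by (intro integral_cong_AE) (auto simp: G_def)
    also have "\<dots> = (\<integral>\<omega>. real_cond_exp M G ?h \<omega> * Z \<omega> \<partial>M)"
      unfolding Z_def by (rule G.real_cond_exp_intg(2)[symmetric, OF int4]) auto
    also have "\<dots> = (\<integral>\<omega>. Z \<omega> * real_cond_exp M G ?h \<omega> \<partial>M)"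
      by (simp add: mult.commute)
    also have "\<dots> = (\<integral>\<omega>. Z \<omega> * ?h \<omega> \<partial>M)"
      by (rule G.real_cond_exp_intg(2)[OF int2]) auto
    finally have eq: "(\<integral>\<omega>. indicator C \<omega> * ?h \<omega> \<partial>M) = (\<integral>\<omega>. Z \<omega> * ?h \<omega> \<partial>M)" .
    have "(\<integral>\<^sup>+\<omega>. indicator C \<omega> * indicator A (V \<omega>) \<partial>M) = (\<integral>\<^sup>+\<omega>. ennreal (indicator C \<omega> * ?h \<omega>) \<partial>M)"
      by (intro nn_integral_cong) (auto simp: indicator_def)
    also have "\<dots> = ennreal (\<integral>\<omega>. indicator C \<omega> * ?h \<omega> \<partial>M)"
      by (rule nn_integral_eq_integral[OF int1]) (auto simp: indicator_def)
    also have "\<dots> = ennreal (\<integral>\<omega>. Z \<omega> * ?h \<omega> \<partial>M)" by (simp add: eq)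
    also have "\<dots> = (\<integral>\<^sup>+\<omega>. ennreal (Z \<omega> * ?h \<omega>) \<partial>M)"
      by (rule nn_integral_eq_integral[OF int2, symmetric]) (use Z0 in \<open>auto simp: indicator_def\<close>)
    also have "\<dots> = (\<integral>\<^sup>+\<omega>. ennreal (Z \<omega>) * indicator A (V \<omega>) \<partial>M)"
      by (intro nn_integral_cong) (auto simp: indicator_def)
    finally show ?thesis .
  qed
  have laws: "distr (density M (indicator C)) N V = distr (density M (\<lambda>\<omega>. ennreal (Z \<omega>))) N V"
  proof (rule measure_eqI)
    fix A assume "A \<in> sets (distr (density M (indicator C)) N V)"
    then have [measurable]: "A \<in> sets N" by simp
    have "emeasure (distr (density M h) N V) A = (\<integral>\<^sup>+\<omega>. h \<omega> * indicator A (V \<omega>) \<partial>M)"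
      if [measurable]: "h \<in> borel_measurable M" for h
      by (auto simp: emeasure_distr emeasure_density intro!: nn_integral_cong split: split_indicator)
    from this[of "indicator C"] this[of "\<lambda>\<omega>. ennreal (Z \<omega>)"] ind[of A]
    show "emeasure (distr (density M (indicator C)) N V) A
        = emeasure (distr (density M (\<lambda>\<omega>. ennreal (Z \<omega>))) N V) A" by simp
  qed simp
  have Z_next: "(\<integral>\<^sup>+\<omega>. indicator C \<omega> * f (V \<omega>) \<partial>M) = (\<integral>\<^sup>+\<omega>. ennreal (Z \<omega>) * f (V \<omega>) \<partial>M)"
    using arg_cong[OF laws, of "\<lambda>D. integral\<^sup>N D f"]
    by (simp add: nn_integral_distr nn_integral_density)
  have Z_present: "(\<integral>\<^sup>+\<omega>. indicator C \<omega> * p (U \<omega>) \<partial>M) = (\<integral>\<^sup>+\<omega>. ennreal (Z \<omega>) * p (U \<omega>) \<partial>M)"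
  proof -
    have pG: "(\<lambda>\<omega>. p (U \<omega>)) \<in> borel_measurable G" using UG p by (rule measurable_compose)
    \<comment> \<open>The nonnegative form of conditional expectation is needed here because
      \<open>p\<close> may be unbounded or infinite, where the real form asks for
      integrability.\<close>
    have "AE \<omega> in M. ennreal (Z \<omega>) = nn_cond_exp M G (indicator C) \<omega>"
    proof (rule G.nn_cond_exp_charact)
      fix D assume D [measurable]: "D \<in> sets G"
      have [measurable]: "D \<in> sets M" using D subG by (auto simp: subalgebra_def)
      have int: "integrable M (\<lambda>\<omega>. indicator D \<omega> * indicator C \<omega> :: real)"
        by (rule integrable_const_bound[where B=1]) (auto simp: indicator_def)
      have int': "integrable M (\<lambda>\<omega>. indicator D \<omega> * Z \<omega>)"
        by (rule Bochner_Integration.integrable_bound[OF Zint]) (auto simp: indicator_def)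
      have "(\<integral>\<^sup>+\<omega>\<in>D. indicator C \<omega> \<partial>M) = (\<integral>\<^sup>+\<omega>. ennreal (indicator D \<omega> * indicator C \<omega>) \<partial>M)"
        by (intro nn_integral_cong) (auto simp: indicator_def)
      also have "\<dots> = ennreal (\<integral>\<omega>. indicator D \<omega> * indicator C \<omega> \<partial>M)"
        by (rule nn_integral_eq_integral[OF int]) (auto simp: indicator_def)
      also have "(\<integral>\<omega>. indicator D \<omega> * indicator C \<omega> \<partial>M) = (\<integral>\<omega>. indicator D \<omega> * Z \<omega> \<partial>M)"
        unfolding Z_def by (rule G.real_cond_exp_intg(2)[symmetric, OF int]) auto
      also have "ennreal \<dots> = (\<integral>\<^sup>+\<omega>. ennreal (indicator D \<omega> * Z \<omega>) \<partial>M)"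
        by (rule nn_integral_eq_integral[OF int', symmetric]) (use Z0 in \<open>auto simp: indicator_def\<close>)
      also have "\<dots> = (\<integral>\<^sup>+\<omega>\<in>D. ennreal (Z \<omega>) \<partial>M)"
        by (intro nn_integral_cong) (auto simp: indicator_def)
      finally show "(\<integral>\<^sup>+\<omega>\<in>D. indicator C \<omega> \<partial>M) = (\<integral>\<^sup>+\<omega>\<in>D. ennreal (Z \<omega>) \<partial>M)" .
    qed auto
    then have "(\<integral>\<^sup>+\<omega>. ennreal (Z \<omega>) * p (U \<omega>) \<partial>M)
             = (\<integral>\<^sup>+\<omega>. p (U \<omega>) * nn_cond_exp M G (indicator C) \<omega> \<partial>M)"
      by (intro nn_integral_cong_AE) (auto simp: mult.commute)
    also have "\<dots> = (\<integral>\<^sup>+\<omega>. p (U \<omega>) * indicator C \<omega> \<partial>M)"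
      by (rule G.nn_cond_exp_intg[OF pG]) auto
    finally show ?thesis by (simp add: mult.commute)
  qed
  \<comment> \<open>The sets of \<open>G\<close> are exactly the preimages under \<open>U\<close>,
    so \<open>p_eq\<close> identifies \<open>p\<close> at the present with the conditional
    expectation of \<open>f\<close> at the next state. The \<open>G\<close>-measurable weight
    \<open>Z\<close> cannot tell the two apart.\<close>
  have "AE \<omega> in M. p (U \<omega>) = nn_cond_exp M G (\<lambda>\<omega>. f (V \<omega>)) \<omega>"
  proof (rule G.nn_cond_exp_charact)
    fix D assume "D \<in> sets G"
    then obtain A where A: "A \<in> sets N" and D: "D = U -` A \<inter> space M" unfolding setsG by blast
    have "(\<integral>\<^sup>+\<omega>\<in>D. h \<omega> \<partial>M) = (\<integral>\<^sup>+\<omega>. indicator A (U \<omega>) * h \<omega> \<partial>M)" for h :: "'w \<Rightarrow> ennreal"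
      unfolding D by (intro nn_integral_cong) (auto simp: indicator_def)
    then show "(\<integral>\<^sup>+\<omega>\<in>D. f (V \<omega>) \<partial>M) = (\<integral>\<^sup>+\<omega>\<in>D. p (U \<omega>) \<partial>M)" using p_eq[OF A] by simp
  qed (use UG in auto)
  then have "(\<integral>\<^sup>+\<omega>. ennreal (Z \<omega>) * p (U \<omega>) \<partial>M)
           = (\<integral>\<^sup>+\<omega>. ennreal (Z \<omega>) * nn_cond_exp M G (\<lambda>\<omega>. f (V \<omega>)) \<omega> \<partial>M)"
    by (intro nn_integral_cong_AE) auto
  also have "\<dots> = (\<integral>\<^sup>+\<omega>. ennreal (Z \<omega>) * f (V \<omega>) \<partial>M)"
    by (rule G.nn_cond_exp_intg) auto
  finally show ?thesis by (simp add: Z_next Z_present)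
qed

section \<open>Path probabilities as words in a self-adjoint operator\<close>

text \<open>The setting of the reversal argument, free of topology and of the grid: time is an
  integer, \<open>N\<close> is any measurable space, \<open>F k\<close> is any sigma-algebra
  containing the past up to \<open>k\<close>, and the Markov property concerns one step. Vanishing
  circulation enters only through \<open>pair_symmetric\<close>.\<close>

locale symmetric_markov_chain = prob_space M
  for M :: "'w measure" +
  fixes N :: "'b measure" and Y :: "int \<Rightarrow> 'w \<Rightarrow> 'b" and F :: "int \<Rightarrow> 'w measure"
  assumes Y_measurable [measurable]: "\<And>k. Y k \<in> measurable M N"
    and subalgebra_past: "\<And>k. subalgebra M (F k)"
    and past: "\<And>j k. j \<le> k \<Longrightarrow> Y j \<in> measurable (F k) N"
    and markov: "\<And>k A. A \<in> sets N \<Longrightarrow> AE \<omega> in M.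
        real_cond_exp M (F k) (\<lambda>\<omega>. indicator A (Y (k + 1) \<omega>)) \<omega>
      = real_cond_exp M (vimage_algebra (space M) (Y k) N) (\<lambda>\<omega>. indicator A (Y (k + 1) \<omega>)) \<omega>"
    and pair_law: "\<And>k. distr M (N \<Otimes>\<^sub>M N) (\<lambda>\<omega>. (Y k \<omega>, Y (k + 1) \<omega>))
                      = distr M (N \<Otimes>\<^sub>M N) (\<lambda>\<omega>. (Y 0 \<omega>, Y 1 \<omega>))"
    and pair_symmetric: "distr M (N \<Otimes>\<^sub>M N) (\<lambda>\<omega>. (Y 1 \<omega>, Y 0 \<omega>))
                       = distr M (N \<Otimes>\<^sub>M N) (\<lambda>\<omega>. (Y 0 \<omega>, Y 1 \<omega>))"
begin

definition \<pi> :: "'b measure" where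
  "\<pi> = distr M N (Y 0)"

text \<open>The transition operator: \<open>P f x\<close> is the conditional expectation of
  \<open>f (Y 1)\<close> given \<open>Y 0 = x\<close>. As a Radon-Nikodym derivative it requires no
  transition kernel and admits infinite values, but it is determined only up to
  \<open>\<pi>\<close>-null sets.\<close>

definition P :: "('b \<Rightarrow> ennreal) \<Rightarrow> 'b \<Rightarrow> ennreal" where
  "P f = RN_deriv \<pi> (distr (density M (\<lambda>\<omega>. f (Y 1 \<omega>))) N (Y 0))"

lemma sets_\<pi> [measurable_cong]: "sets \<pi> = sets N"
  by (simp add: \<pi>_def)

lemma P_measurable [measurable]: "P f \<in> borel_measurable N"
proof -
  have "P f \<in> borel_measurable \<pi>" unfolding P_def by simp
  then show ?thesis by (simp add: measurable_cong_sets[OF sets_\<pi> refl])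
qed

lemma nn_integral_pair:
  assumes [measurable]: "f \<in> borel_measurable N" "g \<in> borel_measurable N"
  shows "(\<integral>\<^sup>+\<omega>. g (Y k \<omega>) * f (Y (k + 1) \<omega>) \<partial>M) = (\<integral>\<^sup>+x. g x * P f x \<partial>\<pi>)"
proof -
  have "(\<integral>\<^sup>+\<omega>. g (Y k \<omega>) * f (Y (k + 1) \<omega>) \<partial>M) = (\<integral>\<^sup>+\<omega>. g (Y 0 \<omega>) * f (Y 1 \<omega>) \<partial>M)"
    using arg_cong[OF pair_law[of k], of "\<lambda>D. \<integral>\<^sup>+p. g (fst p) * f (snd p) \<partial>D"]
    by (simp add: nn_integral_distr)
  also have "\<dots> = (\<integral>\<^sup>+x. g x * P f x \<partial>\<pi>)"
    unfolding P_def \<pi>_def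
    by (rule RN_deriv_distr_nn_integral[symmetric]) (auto intro: prob_space_axioms)
  finally show ?thesis .
qed

text \<open>Both sides are expectations of a product over two successive states, so this is the
  symmetry of the pair law in operator form.\<close>

lemma P_selfadjoint:
  assumes [measurable]: "f \<in> borel_measurable N" "g \<in> borel_measurable N"
  shows "(\<integral>\<^sup>+x. g x * P f x \<partial>\<pi>) = (\<integral>\<^sup>+x. P g x * f x \<partial>\<pi>)"
proof -
  have "(\<integral>\<^sup>+x. g x * P f x \<partial>\<pi>) = (\<integral>\<^sup>+\<omega>. g (Y 0 \<omega>) * f (Y 1 \<omega>) \<partial>M)"
    using nn_integral_pair[of f g 0] by simp
  also have "\<dots> = (\<integral>\<^sup>+\<omega>. g (Y 1 \<omega>) * f (Y 0 \<omega>) \<partial>M)"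
    using arg_cong[OF pair_symmetric, of "\<lambda>D. \<integral>\<^sup>+p. g (fst p) * f (snd p) \<partial>D"]
    by (simp add: nn_integral_distr)
  also have "\<dots> = (\<integral>\<^sup>+x. P g x * f x \<partial>\<pi>)"
    using nn_integral_pair[of g f 0] by (simp add: mult.commute)
  finally show ?thesis .
qed

lemma distr_Y: "distr M N (Y k) = \<pi>"
proof -
  have "distr M N (Y k) = distr (distr M (N \<Otimes>\<^sub>M N) (\<lambda>\<omega>. (Y k \<omega>, Y (k + 1) \<omega>))) N fst"
    by (simp add: distr_distr comp_def)
  also have "\<dots> = \<pi>" unfolding pair_law \<pi>_def by (simp add: distr_distr comp_def)
  finally show ?thesis .
qed

text \<open>Conservation of mass. It holds almost everywhere only, by uniqueness of densities, and
  later allows a factor \<open>P\<close> to be inserted or removed at the end of a word.\<close>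

lemma P_one: "AE x in \<pi>. P (\<lambda>_. 1) x = 1"
proof -
  interpret \<pi>: prob_space \<pi> unfolding \<pi>_def by (rule prob_space_distr) simp
  show ?thesis
  proof (rule \<pi>.density_unique2)
    fix A assume "A \<in> sets \<pi>"
    then have [measurable]: "A \<in> sets N" by (simp add: sets_\<pi>)
    have "(\<integral>\<^sup>+x\<in>A. P (\<lambda>_. 1) x \<partial>\<pi>) = (\<integral>\<^sup>+\<omega>. indicator A (Y 0 \<omega>) \<partial>M)"
      using nn_integral_pair[of "\<lambda>_. 1" "indicator A" 0] by (simp add: mult.commute)
    also have "\<dots> = (\<integral>\<^sup>+x. indicator A x \<partial>\<pi>)"
      unfolding \<pi>_def by (rule nn_integral_distr[symmetric]) measurable
    also have "\<dots> = (\<integral>\<^sup>+x\<in>A. 1 \<partial>\<pi>)" by simp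
    finally show "(\<integral>\<^sup>+x\<in>A. P (\<lambda>_. 1) x \<partial>\<pi>) = (\<integral>\<^sup>+x\<in>A. 1 \<partial>\<pi>)" .
  qed auto
qed

text \<open>One use of the Markov property: on an event of the past, the last step of a path is
  absorbed into \<open>P\<close>. The function \<open>p\<close> of \<open>markov_nn_integral\<close>
  is \<open>P f\<close>, justified by \<open>nn_integral_pair\<close>.\<close>

lemma nn_integral_step:
  assumes C: "C \<in> sets (F k)" and [measurable]: "f \<in> borel_measurable N"
  shows "(\<integral>\<^sup>+\<omega>. indicator C \<omega> * f (Y (k + 1) \<omega>) \<partial>M) = (\<integral>\<^sup>+\<omega>. indicator C \<omega> * P f (Y k \<omega>) \<partial>M)"
proof (rule markov_nn_integral[OF prob_space_axioms subalgebra_past _ _ markov C])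
  fix D assume [measurable]: "D \<in> sets N"
  show "(\<integral>\<^sup>+\<omega>. indicator D (Y k \<omega>) * f (Y (k + 1) \<omega>) \<partial>M)
      = (\<integral>\<^sup>+\<omega>. indicator D (Y k \<omega>) * P f (Y k \<omega>) \<partial>M)"
    using nn_integral_pair[of f "indicator D" k]
    by (simp add: distr_Y[of k, symmetric] nn_integral_distr)
qed auto

text \<open>Every indicator is followed by a \<open>P\<close>, including the last, so
  \<open>g\<close> is evaluated one step after the final set of the list. For \<open>g = 1\<close>
  this extra \<open>P\<close> is harmless by \<open>P_one\<close>.\<close>

abbreviation operator_word :: "'b set list \<Rightarrow> ('b \<Rightarrow> ennreal) \<Rightarrow> 'b \<Rightarrow> ennreal" where
  "operator_word \<equiv> foldr (\<lambda>A u x. indicator A x * P u x)"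

lemma operator_word_measurable:
  "set As \<subseteq> sets N \<Longrightarrow> g \<in> borel_measurable N \<Longrightarrow> operator_word As g \<in> borel_measurable N"
  by (cases As) auto

text \<open>The induction removes sets from the end of the path, where the Markov property acts. The
  removed set and \<open>P\<close> are absorbed into the terminal function, which is why
  \<open>g\<close> must be arbitrary.\<close>

lemma nn_integral_path:
  assumes "set As \<subseteq> sets N" "g \<in> borel_measurable N"
  shows "(\<integral>\<^sup>+\<omega>. indicator {\<omega>\<in>space M. \<forall>i<length As. Y (k + int i) \<omega> \<in> As ! i} \<omega>
                * g (Y (k + int (length As)) \<omega>) \<partial>M)
       = (\<integral>\<^sup>+x. operator_word As g x \<partial>\<pi>)"
  using assms
proof (induction As arbitrary: g rule: rev_induct)
  case Nil
  then have "(\<integral>\<^sup>+x. g x \<partial>\<pi>) = (\<integral>\<^sup>+\<omega>. g (Y k \<omega>) \<partial>M)"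
    unfolding distr_Y[of k, symmetric] by (intro nn_integral_distr) auto
  then show ?case by (simp cong: nn_integral_cong)
next
  case (snoc A As)
  note [measurable] = snoc.prems(2)
  have [measurable]: "A \<in> sets N" and As: "set As \<subseteq> sets N" using snoc.prems by auto
  let ?n = "length As"
  let ?C = "{\<omega>\<in>space M. \<forall>i<length (As @ [A]). Y (k + int i) \<omega> \<in> (As @ [A]) ! i}"
  have C: "?C = {\<omega>\<in>space M. (\<forall>i<?n. Y (k + int i) \<omega> \<in> As ! i) \<and> Y (k + int ?n) \<omega> \<in> A}"
    by (auto simp: nth_append less_Suc_eq)
  \<comment> \<open>The bound \<open>Suc ?n\<close> counts the set \<open>A\<close> at time
    \<open>k + int ?n\<close>, which still belongs to the past at that time; only \<open>g\<close>
    looks one step further. It also makes the index set nonempty, as the finite intersection rule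
    requires.\<close>
  have "?C = (\<Inter>i\<in>{..<Suc ?n}. Y (k + int i) -` ((As @ [A]) ! i) \<inter> space M)"
    by auto
  also have "\<dots> \<in> sets (F (k + int ?n))"
  proof (rule sets.finite_INT)
    fix i assume i: "i \<in> {..<Suc ?n}"
    have "(As @ [A]) ! i \<in> sets N" using snoc.prems(1) i by (auto intro!: subsetD[OF _ nth_mem])
    then have "Y (k + int i) -` ((As @ [A]) ! i) \<inter> space (F (k + int ?n)) \<in> sets (F (k + int ?n))"
      by (intro measurable_sets[OF past]) (use i in auto)
    moreover have "space (F (k + int ?n)) = space M"
      using subalgebra_past by (auto simp: subalgebra_def)
    ultimately show "Y (k + int i) -` ((As @ [A]) ! i) \<inter> space M \<in> sets (F (k + int ?n))"
      by simp
  qed auto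
  finally have CF: "?C \<in> sets (F (k + int ?n))" .
  have "(\<integral>\<^sup>+\<omega>. indicator ?C \<omega> * g (Y (k + int (length (As @ [A]))) \<omega>) \<partial>M)
      = (\<integral>\<^sup>+\<omega>. indicator ?C \<omega> * P g (Y (k + int ?n) \<omega>) \<partial>M)"
    using nn_integral_step[OF CF, of g] by (simp add: ac_simps)
  also have "\<dots> = (\<integral>\<^sup>+\<omega>. indicator {\<omega>\<in>space M. \<forall>i<?n. Y (k + int i) \<omega> \<in> As ! i} \<omega>
                * (indicator A (Y (k + int ?n) \<omega>) * P g (Y (k + int ?n) \<omega>)) \<partial>M)"
    unfolding C by (intro nn_integral_cong) (auto simp: indicator_def)
  also have "\<dots> = (\<integral>\<^sup>+x. operator_word As (\<lambda>x. indicator A x * P g x) x \<partial>\<pi>)"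
    by (rule snoc.IH[OF As]) measurable
  finally show ?case by simp
qed

text \<open>The adjoint of \<open>u\<close> going to \<open>indicator A * P u\<close> is
  \<open>u\<close> going to \<open>P (indicator A * u)\<close>. Moving the factors onto
  \<open>h\<close> one at a time from the front applies them in the opposite order, hence
  \<open>foldl\<close>.\<close>

lemma operator_word_adjoint:
  assumes "set As \<subseteq> sets N" and [measurable]: "g \<in> borel_measurable N" "h \<in> borel_measurable N"
  shows "(\<integral>\<^sup>+x. h x * operator_word As g x \<partial>\<pi>)
       = (\<integral>\<^sup>+x. foldl (\<lambda>u A. P (\<lambda>x. indicator A x * u x)) h As x * g x \<partial>\<pi>)"
  using assms(1,3)
proof (induction As arbitrary: h)
  case (Cons A As)
  note [measurable] = Cons.prems(2)
  have [measurable]: "A \<in> sets N" and As: "set As \<subseteq> sets N" using Cons.prems by auto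
  have [measurable]: "operator_word As g \<in> borel_measurable N"
    by (rule operator_word_measurable[OF As]) simp
  have "(\<integral>\<^sup>+x. h x * operator_word (A # As) g x \<partial>\<pi>)
      = (\<integral>\<^sup>+x. (indicator A x * h x) * P (operator_word As g) x \<partial>\<pi>)"
    by (simp add: ac_simps)
  also have "\<dots> = (\<integral>\<^sup>+x. P (\<lambda>x. indicator A x * h x) x * operator_word As g x \<partial>\<pi>)"
    by (rule P_selfadjoint) measurable
  also have "\<dots> = (\<integral>\<^sup>+x. foldl (\<lambda>u A. P (\<lambda>x. indicator A x * u x)) (P (\<lambda>x. indicator A x * h x)) As x
                        * g x \<partial>\<pi>)"
    by (rule Cons.IH[OF As]) measurable
  finally show ?case by simp
qed simp

text \<open>A regrouping of brackets: in an alternating product with \<open>P\<close> at both ends,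
  each indicator may be paired with the \<open>P\<close> on either side.\<close>

lemma foldl_eq_P_operator_word:
  "foldl (\<lambda>u A. P (\<lambda>x. indicator A x * u x)) (P g) As = P (operator_word (rev As) g)"
  by (induction As rule: rev_induct) auto

text \<open>A word has \<open>P\<close> after its last set but none before its first. Inserting
  \<open>P 1 = 1\<close> in front makes it symmetric, so that its adjoint is the reversed word
  preceded by \<open>P\<close>; that \<open>P\<close> is then moved back onto the constant and
  dropped.\<close>

lemma nn_integral_operator_word_rev:
  assumes As: "set As \<subseteq> sets N"
  shows "(\<integral>\<^sup>+x. operator_word As (\<lambda>_. 1) x \<partial>\<pi>) = (\<integral>\<^sup>+x. operator_word (rev As) (\<lambda>_. 1) x \<partial>\<pi>)"
proof -
  have rev: "set (rev As) \<subseteq> sets N" using As by simp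
  have meas [measurable]: "operator_word Bs (\<lambda>_. 1) \<in> borel_measurable N"
    if "set Bs \<subseteq> sets N" for Bs
    by (rule operator_word_measurable[OF that]) simp
  note [measurable] = meas[OF As] meas[OF rev]
  \<comment> \<open>Starting from \<open>P 1\<close> instead of \<open>1\<close> gives the
    \<open>foldl\<close> the shape that \<open>foldl_eq_P_operator_word\<close> expects.\<close>
  have "(\<integral>\<^sup>+x. operator_word As (\<lambda>_. 1) x \<partial>\<pi>)
      = (\<integral>\<^sup>+x. P (\<lambda>_. 1) x * operator_word As (\<lambda>_. 1) x \<partial>\<pi>)"
    using P_one by (intro nn_integral_cong_AE) auto
  also have "\<dots> = (\<integral>\<^sup>+x. P (operator_word (rev As) (\<lambda>_. 1)) x * 1 \<partial>\<pi>)"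
    using operator_word_adjoint[OF As, of "\<lambda>_. 1" "P (\<lambda>_. 1)"]
    by (simp add: foldl_eq_P_operator_word)
  also have "\<dots> = (\<integral>\<^sup>+x. operator_word (rev As) (\<lambda>_. 1) x * P (\<lambda>_. 1) x \<partial>\<pi>)"
    by (rule P_selfadjoint[symmetric]) (auto intro: meas[OF rev])
  also have "\<dots> = (\<integral>\<^sup>+x. operator_word (rev As) (\<lambda>_. 1) x \<partial>\<pi>)"
    using P_one by (intro nn_integral_cong_AE) auto
  finally show ?thesis .
qed

text \<open>A window symmetric about time 0 is mapped to itself by time reversal, so reversing the
  path amounts to reversing the list of its sets. For negative \<open>m\<close> the window is empty
  and both events are the whole space.\<close>

lemma window_reversible:
  assumes A: "\<And>i. A i \<in> sets N"
  shows "emeasure M {\<omega>\<in>space M. \<forall>i\<in>{-m..m}. Y i \<omega> \<in> A i}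
       = emeasure M {\<omega>\<in>space M. \<forall>i\<in>{-m..m}. Y (- i) \<omega> \<in> A i}"
proof (cases "m \<ge> 0")
  case True
  define n where "n = nat (2 * m + 1)"
  have n: "int n = 2 * m + 1" using True by (simp add: n_def)
  have path: "emeasure M {\<omega>\<in>space M. \<forall>i\<in>{-m..m}. Y i \<omega> \<in> B i}
            = (\<integral>\<^sup>+x. operator_word (map (\<lambda>i. B (- m + int i)) [0..<n]) (\<lambda>_. 1) x \<partial>\<pi>)"
    if B: "\<And>i. B i \<in> sets N" for B
  proof -
    note [measurable] = B
    have win: "(\<forall>i\<in>{-m..m}. Q i) \<longleftrightarrow> (\<forall>i<n. Q (- m + int i))" for Q
    proof safe
      fix i :: int assume Q: "\<forall>i<n. Q (- m + int i)" and i: "i \<in> {-m..m}"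
      have "nat (i + m) < n" using i n by auto
      then have "Q (- m + int (nat (i + m)))" using Q by blast
      then show "Q i" using i by simp
    qed (use n in auto)
    have "(\<integral>\<^sup>+x. operator_word (map (\<lambda>i. B (- m + int i)) [0..<n]) (\<lambda>_. 1) x \<partial>\<pi>)
        = (\<integral>\<^sup>+\<omega>. indicator {\<omega>\<in>space M. \<forall>i\<in>{-m..m}. Y i \<omega> \<in> B i} \<omega> \<partial>M)"
      by (subst nn_integral_path[where k="- m", symmetric]) (use B in \<open>auto simp: win\<close>)
    also have "\<dots> = emeasure M {\<omega>\<in>space M. \<forall>i\<in>{-m..m}. Y i \<omega> \<in> B i}"
      by (rule nn_integral_indicator) measurable
    finally show ?thesis by simp
  qed
  \<comment> \<open>Position \<open>i\<close> from the end holds time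
    \<open>-m + (n - 1 - i)\<close>, which is \<open>m - i\<close> because
    \<open>n = 2 * m + 1\<close>.\<close>
  have rev: "rev (map (\<lambda>i. A (- m + int i)) [0..<n]) = map (\<lambda>i. A (- (- m + int i))) [0..<n]"
  proof (rule nth_equalityI)
    fix i assume "i < length (rev (map (\<lambda>i. A (- m + int i)) [0..<n]))"
    then have i: "i < n" by simp
    then have "rev (map (\<lambda>i. A (- m + int i)) [0..<n]) ! i = A (- m + int (n - Suc i))"
      by (simp add: rev_nth)
    also have "- m + int (n - Suc i) = - (- m + int i)" using i n by (simp add: of_nat_diff)
    finally show "rev (map (\<lambda>i. A (- m + int i)) [0..<n]) ! i = map (\<lambda>i. A (- (- m + int i))) [0..<n] ! i"
      using i by simp
  qed simp
  have "emeasure M {\<omega>\<in>space M. \<forall>i\<in>{-m..m}. Y i \<omega> \<in> A i}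
      = (\<integral>\<^sup>+x. operator_word (map (\<lambda>i. A (- (- m + int i))) [0..<n]) (\<lambda>_. 1) x \<partial>\<pi>)"
    unfolding path[OF A] rev[symmetric] by (rule nn_integral_operator_word_rev) (use A in auto)
  also have "\<dots> = emeasure M {\<omega>\<in>space M. \<forall>i\<in>{-m..m}. Y i \<omega> \<in> A (- i)}"
    by (rule path[symmetric, where B="\<lambda>i. A (- i)"]) (rule A)
  also have "{\<omega>\<in>space M. \<forall>i\<in>{-m..m}. Y i \<omega> \<in> A (- i)}
           = {\<omega>\<in>space M. \<forall>i\<in>{-m..m}. Y (- i) \<omega> \<in> A i}"
    by (force dest: bspec[where x="- i" for i])
  finally show ?thesis .
qed simp

end

section \<open>Continuity of the circulation\<close>

text \<open>Integrability comes from \<open>\<bar>a * b\<bar> \<le> a\<^sup>2 + b\<^sup>2\<close>;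
  it then allows the inequality for nonnegative integrals to be read in the reals.\<close>

lemma Cauchy_Schwarz_integral:
  fixes f g :: "'a \<Rightarrow> real"
  assumes [measurable]: "f \<in> borel_measurable M" "g \<in> borel_measurable M"
    and f2: "integrable M (\<lambda>x. (f x)\<^sup>2)" and g2: "integrable M (\<lambda>x. (g x)\<^sup>2)"
  shows "integrable M (\<lambda>x. f x * g x)"
    and "\<bar>\<integral>x. f x * g x \<partial>M\<bar> \<le> sqrt (\<integral>x. (f x)\<^sup>2 \<partial>M) * sqrt (\<integral>x. (g x)\<^sup>2 \<partial>M)"
proof -
  show int: "integrable M (\<lambda>x. f x * g x)"
  proof (rule Bochner_Integration.integrable_bound)
    show "integrable M (\<lambda>x. (f x)\<^sup>2 + (g x)\<^sup>2)" using f2 g2 by simp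
    have "\<bar>a * b\<bar> \<le> a\<^sup>2 + b\<^sup>2" for a b :: real
      using sum_squares_bound[of "\<bar>a\<bar>" "\<bar>b\<bar>"] mult_nonneg_nonneg[of "\<bar>a\<bar>" "\<bar>b\<bar>"]
      unfolding abs_mult power2_abs by linarith
    then show "AE x in M. norm (f x * g x) \<le> norm ((f x)\<^sup>2 + (g x)\<^sup>2)"
      by (simp add: abs_mult)
  qed simp
  have "ennreal ((\<integral>x. \<bar>f x * g x\<bar> \<partial>M)\<^sup>2) = (\<integral>\<^sup>+x. ennreal \<bar>f x * g x\<bar> \<partial>M)\<^sup>2"
    using int by (subst nn_integral_eq_integral) (auto simp: ennreal_power)
  also have "\<dots> = (\<integral>\<^sup>+x. ennreal \<bar>f x\<bar> * ennreal \<bar>g x\<bar> \<partial>M)\<^sup>2"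
    by (simp add: abs_mult ennreal_mult)
  also have "\<dots> \<le> (\<integral>\<^sup>+x. (ennreal \<bar>f x\<bar>)\<^sup>2 \<partial>M) * (\<integral>\<^sup>+x. (ennreal \<bar>g x\<bar>)\<^sup>2 \<partial>M)"
    by (rule Cauchy_Schwarz_nn_integral) auto
  also have "\<dots> = ennreal ((\<integral>x. (f x)\<^sup>2 \<partial>M) * (\<integral>x. (g x)\<^sup>2 \<partial>M))"
    using f2 g2 by (simp add: ennreal_power nn_integral_eq_integral ennreal_mult)
  finally have "(\<integral>x. \<bar>f x * g x\<bar> \<partial>M)\<^sup>2 \<le> (\<integral>x. (f x)\<^sup>2 \<partial>M) * (\<integral>x. (g x)\<^sup>2 \<partial>M)"
    by (simp add: ennreal_le_iff)
  then have "(\<integral>x. \<bar>f x * g x\<bar> \<partial>M) \<le> sqrt ((\<integral>x. (f x)\<^sup>2 \<partial>M) * (\<integral>x. (g x)\<^sup>2 \<partial>M))"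
    by (rule real_le_rsqrt)
  then show "\<bar>\<integral>x. f x * g x \<partial>M\<bar> \<le> sqrt (\<integral>x. (f x)\<^sup>2 \<partial>M) * sqrt (\<integral>x. (g x)\<^sup>2 \<partial>M)"
    unfolding real_sqrt_mult by (rule order_trans[OF integral_abs_bound])
qed

lemma L2_space_add:
  assumes f: "f \<in> L2_space \<pi>" and g: "g \<in> L2_space \<pi>"
  shows "(\<lambda>x. f x + g x) \<in> L2_space \<pi>"
proof -
  have [measurable]: "f \<in> borel_measurable \<pi>" "g \<in> borel_measurable \<pi>"
    and "integrable \<pi> (\<lambda>x. (f x)\<^sup>2)" "integrable \<pi> (\<lambda>x. (g x)\<^sup>2)"
    using f g by (auto simp: L2_space_def)
  then have "integrable \<pi> (\<lambda>x. (f x)\<^sup>2 + (g x)\<^sup>2 + 2 * (f x * g x))"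
    using Cauchy_Schwarz_integral(1)[of f \<pi> g] by auto
  then show ?thesis by (simp add: L2_space_def power2_sum mult.assoc)
qed

lemma L2_space_cmult: "f \<in> L2_space \<pi> \<Longrightarrow> (\<lambda>x. c * f x) \<in> L2_space \<pi>"
  by (auto simp: L2_space_def power_mult_distrib)

lemma L2_space_sum:
  assumes "finite I" "\<And>i. i \<in> I \<Longrightarrow> f i \<in> L2_space \<pi>"
  shows "(\<lambda>x. \<Sum>i\<in>I. f i x) \<in> L2_space \<pi>"
  using assms
proof (induction I rule: finite_induct)
  case empty
  show ?case by (simp add: L2_space_def)
next
  case (insert i I)
  then show ?case using L2_space_add[of "f i" \<pi> "\<lambda>x. \<Sum>i\<in>I. f i x"] by simp
qed

text \<open>Cauchy-Schwarz on the sample space: the two norms see only the marginal laws, so the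
  bound is independent of the coupling of \<open>U\<close> and \<open>V\<close>.\<close>

lemma L2_product:
  assumes [measurable]: "U \<in> measurable M N" "V \<in> measurable M N"
    and U: "distr M N U = \<pi>" and V: "distr M N V = \<pi>"
    and f: "f \<in> L2_space \<pi>" and g: "g \<in> L2_space \<pi>"
  shows "integrable M (\<lambda>\<omega>. f (U \<omega>) * g (V \<omega>))"
    and "\<bar>\<integral>\<omega>. f (U \<omega>) * g (V \<omega>) \<partial>M\<bar> \<le> L2_norm \<pi> f * L2_norm \<pi> g"
proof -
  have N: "sets \<pi> = sets N" using U by auto
  have [measurable]: "f \<in> borel_measurable N" "g \<in> borel_measurable N"
    using f g by (auto simp: L2_space_def measurable_cong_sets[OF N refl])
  have "integrable M (\<lambda>\<omega>. (f (U \<omega>))\<^sup>2)" "integrable M (\<lambda>\<omega>. (g (V \<omega>))\<^sup>2)"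
    using f g integrable_distr_eq[of U M N "\<lambda>x. (f x)\<^sup>2"] integrable_distr_eq[of V M N "\<lambda>x. (g x)\<^sup>2"]
    by (auto simp: L2_space_def U V)
  note CS = Cauchy_Schwarz_integral[OF _ _ this]
  show "integrable M (\<lambda>\<omega>. f (U \<omega>) * g (V \<omega>))" by (rule CS) measurable
  have "L2_norm \<pi> f = sqrt (\<integral>\<omega>. (f (U \<omega>))\<^sup>2 \<partial>M)" "L2_norm \<pi> g = sqrt (\<integral>\<omega>. (g (V \<omega>))\<^sup>2 \<partial>M)"
    unfolding L2_norm_def
    using integral_distr[of U M N "\<lambda>x. (f x)\<^sup>2"] integral_distr[of V M N "\<lambda>x. (g x)\<^sup>2"]
    by (auto simp: U V)
  then show "\<bar>\<integral>\<omega>. f (U \<omega>) * g (V \<omega>) \<partial>M\<bar> \<le> L2_norm \<pi> f * L2_norm \<pi> g"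
    using CS(2) by simp
qed

lemma feature_circulation_swap:
  "feature_circulation M X t h \<phi> \<psi> = - feature_circulation M X t h \<psi> \<phi>"
  by (simp add: feature_circulation_def field_simps)

section \<open>The circulation at a fixed time and lag as a bounded antisymmetric bilinear
  form\<close>

context
  fixes M :: "'w measure" and X :: "real \<Rightarrow> 'w \<Rightarrow> 'b" and N \<pi> :: "'b measure" and t h :: real
  assumes X_measurable: "X t \<in> measurable M N" "X (t + h) \<in> measurable M N"
    and X_law: "distr M N (X t) = \<pi>" "distr M N (X (t + h)) = \<pi>"
begin

lemma feature_circulation_add:
  assumes "f \<in> L2_space \<pi>" "g \<in> L2_space \<pi>" "\<phi> \<in> L2_space \<pi>"
  shows "feature_circulation M X t h (\<lambda>x. f x + g x) \<phi>
       = feature_circulation M X t h f \<phi> + feature_circulation M X t h g \<phi>"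
  using L2_product(1)[OF X_measurable(2,1) X_law(2,1) assms(1,3)]
    L2_product(1)[OF X_measurable(2,1) X_law(2,1) assms(2,3)]
    L2_product(1)[OF X_measurable(2,1) X_law(2,1) assms(3,1)]
    L2_product(1)[OF X_measurable(2,1) X_law(2,1) assms(3,2)]
  by (simp add: feature_circulation_def distrib_left distrib_right field_simps)

lemma feature_circulation_cmult:
  "feature_circulation M X t h (\<lambda>x. c * f x) \<phi> = c * feature_circulation M X t h f \<phi>"
  by (simp add: feature_circulation_def mult.assoc mult.left_commute[of _ c] right_diff_distrib)

lemma feature_circulation_sum:
  assumes "finite I" "\<And>i. i \<in> I \<Longrightarrow> f i \<in> L2_space \<pi>" "\<phi> \<in> L2_space \<pi>"
  shows "feature_circulation M X t h (\<lambda>x. \<Sum>i\<in>I. f i x) \<phi>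
       = (\<Sum>i\<in>I. feature_circulation M X t h (f i) \<phi>)"
  using assms(1,2)
proof (induction I rule: finite_induct)
  case empty
  show ?case by (simp add: feature_circulation_def)
next
  case (insert i I)
  then show ?case
    using feature_circulation_add[of "f i" "\<lambda>x. \<Sum>i\<in>I. f i x" \<phi>] L2_space_sum[of I f \<pi>] assms(3)
    by simp
qed

lemma feature_circulation_bound:
  assumes "f \<in> L2_space \<pi>" "\<phi> \<in> L2_space \<pi>"
  shows "\<bar>feature_circulation M X t h f \<phi>\<bar> \<le> L2_norm \<pi> f * L2_norm \<pi> \<phi>"
  using L2_product(2)[OF X_measurable(2,1) X_law(2,1) assms]
    L2_product(2)[OF X_measurable(2,1) X_law(2,1) assms(2,1)]
  by (simp add: feature_circulation_def mult.commute[of "L2_norm \<pi> \<phi>"] abs_le_iff)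

text \<open>A bounded linear functional that vanishes on a set with dense span vanishes everywhere.
  The other argument stays fixed, so the two variables can be treated in turn.\<close>

lemma feature_circulation_zero_left:
  assumes S: "complete_system \<pi> S" and \<phi>: "\<phi> \<in> L2_space \<pi>"
    and zero: "\<And>\<psi>. \<psi> \<in> S \<Longrightarrow> feature_circulation M X t h \<psi> \<phi> = 0"
    and \<psi>: "\<psi> \<in> L2_space \<pi>"
  shows "feature_circulation M X t h \<psi> \<phi> = 0"
proof (rule ccontr)
  let ?Q = "\<lambda>f. feature_circulation M X t h f \<phi>"
  assume neq: "?Q \<psi> \<noteq> 0"
  have norm: "L2_norm \<pi> \<phi> \<ge> 0" by (simp add: L2_norm_def)
  \<comment> \<open>The summand 1 keeps the quotient defined when \<open>\<phi>\<close> has seminorm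
    zero, and it makes the final inequality strict.\<close>
  define \<epsilon> where "\<epsilon> = \<bar>?Q \<psi>\<bar> / (L2_norm \<pi> \<phi> + 1)"
  have "\<epsilon> > 0" using neq norm by (simp add: \<epsilon>_def)
  then obtain g where g: "g \<in> linear_span S" and close: "L2_norm \<pi> (\<lambda>x. \<psi> x - g x) < \<epsilon>"
    using S \<psi> unfolding complete_system_def by blast
  from g obtain F c where F: "finite F" "F \<subseteq> S" and g_eq: "g = (\<lambda>x. \<Sum>f\<in>F. c f * f x)"
    by (auto simp: linear_span_def)
  have SL: "S \<subseteq> L2_space \<pi>" using S by (simp add: complete_system_def)
  then have cf: "(\<lambda>x. c f * f x) \<in> L2_space \<pi>" if "f \<in> F" for f
    using that F by (intro L2_space_cmult) auto
  have gL: "g \<in> L2_space \<pi>" unfolding g_eq using F(1) cf by (rule L2_space_sum)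
  have "?Q g = (\<Sum>f\<in>F. ?Q (\<lambda>x. c f * f x))"
    unfolding g_eq by (rule feature_circulation_sum[OF F(1) cf \<phi>])
  also have "\<dots> = 0"
    using F(2) zero by (intro sum.neutral) (auto simp: feature_circulation_cmult)
  finally have Qg: "?Q g = 0" .
  have dL: "(\<lambda>x. \<psi> x - g x) \<in> L2_space \<pi>"
    using L2_space_add[OF \<psi> L2_space_cmult[OF gL, of "- 1"]] by simp
  have "?Q \<psi> = ?Q (\<lambda>x. \<psi> x - g x)"
    using feature_circulation_add[OF dL gL \<phi>] Qg by simp
  then have "\<bar>?Q \<psi>\<bar> \<le> L2_norm \<pi> (\<lambda>x. \<psi> x - g x) * L2_norm \<pi> \<phi>"
    using feature_circulation_bound[OF dL \<phi>] by simp
  also have "\<dots> \<le> \<epsilon> * L2_norm \<pi> \<phi>" using close norm by (intro mult_right_mono) auto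
  also have "\<dots> < \<epsilon> * (L2_norm \<pi> \<phi> + 1)" using \<open>\<epsilon> > 0\<close> by simp
  also have "\<dots> = \<bar>?Q \<psi>\<bar>" using norm by (simp add: \<epsilon>_def)
  finally show False by simp
qed

text \<open>Density is used twice: first with the second argument in \<open>S\<close>, then, after
  exchanging the arguments by antisymmetry, for the other variable.\<close>

lemma feature_circulation_zero:
  assumes S: "complete_system \<pi> S"
    and zero: "\<And>\<psi> \<phi>. \<psi> \<in> S \<Longrightarrow> \<phi> \<in> S \<Longrightarrow> feature_circulation M X t h \<psi> \<phi> = 0"
    and \<psi>: "\<psi> \<in> L2_space \<pi>" and \<phi>: "\<phi> \<in> L2_space \<pi>"
  shows "feature_circulation M X t h \<psi> \<phi> = 0"
proof (rule feature_circulation_zero_left[OF S \<phi> _ \<psi>])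
  fix \<psi>' assume \<psi>': "\<psi>' \<in> S"
  then have "\<psi>' \<in> L2_space \<pi>" using S by (auto simp: complete_system_def)
  then have "feature_circulation M X t h \<phi> \<psi>' = 0"
    by (rule feature_circulation_zero_left[OF S _ zero[OF _ \<psi>'] \<phi>])
  then show "feature_circulation M X t h \<psi>' \<phi> = 0"
    by (simp add: feature_circulation_swap[of M X t h \<psi>'])
qed

end

section \<open>From vanishing circulation to a symmetric pair law\<close>

lemma pair_measure_eqI_rectangles:
  assumes "finite_measure \<mu>" and sets: "sets \<mu> = sets (A \<Otimes>\<^sub>M B)" "sets \<nu> = sets (A \<Otimes>\<^sub>M B)"
    and eq: "\<And>a b. a \<in> sets A \<Longrightarrow> b \<in> sets B \<Longrightarrow> emeasure \<mu> (a \<times> b) = emeasure \<nu> (a \<times> b)"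
  shows "\<mu> = \<nu>"
proof -
  interpret finite_measure \<mu> by fact
  show ?thesis
  proof (rule measure_eqI_generator_eq[OF Int_stable_pair_measure_generator[of A B],
        where \<Omega>="space A \<times> space B" and A="\<lambda>_. space A \<times> space B"])
    show "{a \<times> b |a b. a \<in> sets A \<and> b \<in> sets B} \<subseteq> Pow (space A \<times> space B)"
      by (auto dest: sets.sets_into_space)
    show "emeasure \<mu> (space A \<times> space B) \<noteq> \<infinity>" by simp
  qed (use sets eq in \<open>auto simp: sets_pair_measure\<close>)
qed

text \<open>Indicators are square integrable because \<open>\<pi>\<close> is a probability. For the
  indicators of \<open>a\<close> and \<open>b\<close>, the circulation is half the difference of the
  probabilities that the two laws give to the rectangle \<open>a \<times> b\<close>, and rectangles
  determine a law.\<close>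

lemma pair_law_symmetricI:
  assumes "prob_space M" and [measurable]: "X t \<in> measurable M N" "X (t + h) \<in> measurable M N"
    and law: "distr M N (X t) = \<pi>" "distr M N (X (t + h)) = \<pi>"
    and S: "complete_system \<pi> S"
    and zero: "\<And>\<psi> \<phi>. \<psi> \<in> S \<Longrightarrow> \<phi> \<in> S \<Longrightarrow> feature_circulation M X t h \<psi> \<phi> = 0"
  shows "distr M (N \<Otimes>\<^sub>M N) (\<lambda>\<omega>. (X (t + h) \<omega>, X t \<omega>)) = distr M (N \<Otimes>\<^sub>M N) (\<lambda>\<omega>. (X t \<omega>, X (t + h) \<omega>))"
    (is "?\<mu> = ?\<nu>")
proof (rule pair_measure_eqI_rectangles)
  interpret prob_space M by fact
  show "finite_measure ?\<mu>" by (rule finite_measure_distr) measurable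
  fix a b assume [measurable]: "a \<in> sets N" "b \<in> sets N"
  interpret \<pi>: prob_space \<pi> unfolding law(1)[symmetric] by (rule prob_space_distr) measurable
  have L2: "indicator c \<in> L2_space \<pi>" if [measurable]: "c \<in> sets N" for c
  proof -
    have [measurable]: "c \<in> sets \<pi>" unfolding law(1)[symmetric] by simp
    show ?thesis unfolding L2_space_def
      by (auto intro!: \<pi>.integrable_const_bound[where B=1] simp: indicator_def)
  qed
  have joint: "(\<integral>\<omega>. (indicator c (U \<omega>) :: real) * indicator d (V \<omega>) \<partial>M) = measure M {\<omega>\<in>space M. U \<omega> \<in> c \<and> V \<omega> \<in> d}"
    if [measurable]: "U \<in> measurable M N" "V \<in> measurable M N" "c \<in> sets N" "d \<in> sets N" for U V c d
  proof -
    have "(\<integral>\<omega>. (indicator c (U \<omega>) :: real) * indicator d (V \<omega>) \<partial>M)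
        = (\<integral>\<omega>. indicator {\<omega>\<in>space M. U \<omega> \<in> c \<and> V \<omega> \<in> d} \<omega> \<partial>M)"
      by (intro Bochner_Integration.integral_cong) (auto simp: indicator_def)
    also have "\<dots> = measure M {\<omega>\<in>space M. U \<omega> \<in> c \<and> V \<omega> \<in> d}" by simp
    finally show ?thesis .
  qed
  have "feature_circulation M X t h (indicator a) (indicator b) = 0"
    by (rule feature_circulation_zero[OF assms(2,3) law S zero]) (auto intro: L2)
  then have "measure M {\<omega>\<in>space M. X (t + h) \<omega> \<in> a \<and> X t \<omega> \<in> b}
           = measure M {\<omega>\<in>space M. X t \<omega> \<in> a \<and> X (t + h) \<omega> \<in> b}"
    by (simp add: feature_circulation_def joint conj_commute)
  moreover have "(\<lambda>\<omega>. (U \<omega>, V \<omega>)) -` (a \<times> b) \<inter> space M = {\<omega>\<in>space M. U \<omega> \<in> a \<and> V \<omega> \<in> b}" for U V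
    by auto
  ultimately show "emeasure ?\<mu> (a \<times> b) = emeasure ?\<nu> (a \<times> b)"
    by (simp add: emeasure_distr emeasure_eq_measure)
qed auto

section \<open>Processes on the time grid\<close>

lemma time_grid_add:
  assumes "s \<in> time_grid \<Delta>" "t \<in> time_grid \<Delta>"
  shows "s + t \<in> time_grid \<Delta>"
proof -
  obtain j k where "s = \<Delta> * of_int j" "t = \<Delta> * of_int k"
    using assms unfolding time_grid_def by blast
  then have "s + t = \<Delta> * of_int (j + k)" by (simp add: distrib_left)
  then show ?thesis unfolding time_grid_def by blast
qed

lemma time_grid_uminus:
  assumes "s \<in> time_grid \<Delta>"
  shows "- s \<in> time_grid \<Delta>"
proof -
  obtain k where "s = \<Delta> * of_int k"
    using assms unfolding time_grid_def by blast
  then have "- s = \<Delta> * of_int (- k)" by simp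
  then show ?thesis unfolding time_grid_def by blast
qed

text \<open>Pair laws are images of the process law, so equalities of process laws, as in
  stationarity and reversibility, pass to pairs of times.\<close>

lemma pair_law_process_law:
  assumes X: "is_process M T X" and "a \<in> T" "b \<in> T"
  shows "distr M (borel \<Otimes>\<^sub>M borel) (\<lambda>\<omega>. (X a \<omega>, X b \<omega>))
       = distr (process_law M T X) (borel \<Otimes>\<^sub>M borel) (\<lambda>x. (x a, x b))"
proof -
  have [measurable]: "(\<lambda>\<omega>. \<lambda>t\<in>T. X t \<omega>) \<in> measurable M (\<Pi>\<^sub>M t\<in>T. borel)"
    using X by (intro measurable_restrict) (auto simp: is_process_def)
  have [measurable]: "(\<lambda>x. (x a, x b)) \<in> measurable (\<Pi>\<^sub>M t\<in>T. borel) (borel \<Otimes>\<^sub>M borel)"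
    using assms(2,3) by (intro measurable_Pair measurable_component_singleton)
  show ?thesis unfolding process_law_def using assms(2,3)
    by (simp add: distr_distr comp_def)
qed

lemma stationary_pair_law:
  assumes X: "is_process M (time_grid \<Delta>) X" and stat: "strictly_stationary M (time_grid \<Delta>) X"
    and T: "a \<in> time_grid \<Delta>" "b \<in> time_grid \<Delta>" "s \<in> time_grid \<Delta>"
  shows "distr M (borel \<Otimes>\<^sub>M borel) (\<lambda>\<omega>. (X (a + s) \<omega>, X (b + s) \<omega>))
       = distr M (borel \<Otimes>\<^sub>M borel) (\<lambda>\<omega>. (X a \<omega>, X b \<omega>))"
proof -
  have "is_process M (time_grid \<Delta>) (\<lambda>t. X (t + s))"
    using X T(3) by (auto simp: is_process_def intro: time_grid_add)
  from pair_law_process_law[OF this T(1,2)] pair_law_process_law[OF X T(1,2)]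
  show ?thesis using stat T(3) by (simp add: strictly_stationary_def)
qed

lemma reversible_pair_law:
  assumes X: "is_process M (time_grid \<Delta>) X" and rev: "reversible M (time_grid \<Delta>) X"
    and T: "a \<in> time_grid \<Delta>" "b \<in> time_grid \<Delta>"
  shows "distr M (borel \<Otimes>\<^sub>M borel) (\<lambda>\<omega>. (X (- a) \<omega>, X (- b) \<omega>))
       = distr M (borel \<Otimes>\<^sub>M borel) (\<lambda>\<omega>. (X a \<omega>, X b \<omega>))"
proof -
  have "is_process M (time_grid \<Delta>) (\<lambda>t. X (- t))"
    using X by (auto simp: is_process_def intro: time_grid_uminus)
  from pair_law_process_law[OF this T] pair_law_process_law[OF X T]
  show ?thesis using rev by (simp add: reversible_def)
qed

text \<open>Stationarity identifies the law at times \<open>(t, t + h)\<close> with that at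
  \<open>(-(t + h), -t)\<close>, and reversibility turns the latter into that at
  \<open>(t + h, t)\<close>. The pair is therefore exchangeable and the two expectations
  cancel.\<close>

lemma reversible_feature_circulation:
  fixes X :: "real \<Rightarrow> 'w \<Rightarrow> 'b :: second_countable_topology"
  assumes X: "is_process M (time_grid \<Delta>) X" and stat: "strictly_stationary M (time_grid \<Delta>) X"
    and rev: "reversible M (time_grid \<Delta>) X"
    and T: "t \<in> time_grid \<Delta>" "h \<in> time_grid \<Delta>"
    and [measurable]: "\<psi> \<in> borel_measurable borel" "\<phi> \<in> borel_measurable borel"
  shows "feature_circulation M X t h \<psi> \<phi> = 0"
proof -
  note grid = time_grid_add time_grid_uminus
  have th: "t + h \<in> time_grid \<Delta>" using T by (rule time_grid_add)
  have [measurable]: "X t \<in> borel_measurable M" "X (t + h) \<in> borel_measurable M"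
    using X T(1) th by (auto simp: is_process_def)
  have "distr M (borel \<Otimes>\<^sub>M borel) (\<lambda>\<omega>. (X t \<omega>, X (t + h) \<omega>))
      = distr M (borel \<Otimes>\<^sub>M borel) (\<lambda>\<omega>. (X (- (t + h)) \<omega>, X (- t) \<omega>))"
    \<comment> \<open>The shift is by \<open>t + (t + h)\<close>, which sends
      \<open>-(t + h)\<close> to \<open>t\<close> and \<open>-t\<close> to
      \<open>t + h\<close>.\<close>
    using stationary_pair_law[OF X stat grid(2)[OF th] grid(2)[OF T(1)] grid(1)[OF T(1) th]] by simp
  also have "\<dots> = distr M (borel \<Otimes>\<^sub>M borel) (\<lambda>\<omega>. (X (t + h) \<omega>, X t \<omega>))"
    by (rule reversible_pair_law[OF X rev th T(1)])
  finally have law: "distr M (borel \<Otimes>\<^sub>M borel) (\<lambda>\<omega>. (X t \<omega>, X (t + h) \<omega>))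
                   = distr M (borel \<Otimes>\<^sub>M borel) (\<lambda>\<omega>. (X (t + h) \<omega>, X t \<omega>))" .
  have "(\<integral>\<omega>. \<phi> (X (t + h) \<omega>) * \<psi> (X t \<omega>) \<partial>M) = (\<integral>\<omega>. \<phi> (X t \<omega>) * \<psi> (X (t + h) \<omega>) \<partial>M)"
    using arg_cong[OF law, of "\<lambda>D. integral\<^sup>L D (\<lambda>p. \<phi> (fst p) * \<psi> (snd p))"]
    by (simp add: integral_distr)
  then show ?thesis by (simp add: feature_circulation_def mult.commute)
qed

section \<open>Sigma-algebras generated by the process\<close>

lemma space_generated_algebra [simp]: "space (generated_algebra M S X) = space M"
  unfolding generated_algebra_def by (rule space_measure_of) auto

lemma sets_generated_algebra:
  "sets (generated_algebra M S X)
 = sigma_sets (space M) (\<Union>s\<in>S. {X s -` A \<inter> space M | A. A \<in> sets borel})"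
  unfolding generated_algebra_def by (rule sets_measure_of) auto

lemma generated_algebra_singleton:
  "generated_algebra M {s} X = vimage_algebra (space M) (X s) borel"
  by (simp add: generated_algebra_def vimage_algebra_def)

lemma subalgebra_generated_algebra:
  assumes "\<And>s. s \<in> S \<Longrightarrow> X s \<in> borel_measurable M"
  shows "subalgebra M (generated_algebra M S X)"
  unfolding subalgebra_def sets_generated_algebra
  using assms by (auto intro!: sets.sigma_sets_subset simp: measurable_sets)

lemma measurable_generated_algebra:
  fixes X :: "real \<Rightarrow> 'w \<Rightarrow> 'b :: topological_space"
  assumes "s \<in> S"
  shows "X s \<in> borel_measurable (generated_algebra M S X)"
proof (rule measurableI)
  fix A :: "'b set" assume "A \<in> sets borel"
  then show "X s -` A \<inter> space (generated_algebra M S X) \<in> sets (generated_algebra M S X)"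
    unfolding sets_generated_algebra space_generated_algebra
    using assms by (intro sigma_sets.Basic) blast
qed simp

text \<open>Finite-dimensional cylinders determine the process law, and finitely many grid times
  always fit into a symmetric window of integers, the remaining times of which are left
  unconstrained.\<close>

lemma reversibleI_windows:
  fixes X :: "real \<Rightarrow> 'w \<Rightarrow> 'b :: topological_space"
  assumes "prob_space M" and \<Delta>: "\<Delta> > 0" and X: "is_process M (time_grid \<Delta>) X"
    and window: "\<And>m A. (\<And>i::int. A i \<in> sets (borel :: 'b measure)) \<Longrightarrow>
        emeasure M {\<omega>\<in>space M. \<forall>i\<in>{-m..m}. X (\<Delta> * of_int i) \<omega> \<in> A i}
      = emeasure M {\<omega>\<in>space M. \<forall>i\<in>{-m..m}. X (\<Delta> * of_int (- i)) \<omega> \<in> A i}"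
  shows "reversible M (time_grid \<Delta>) X"
  unfolding reversible_def
proof (rule measure_eqI_PiM_infinite)
  interpret prob_space M by fact
  let ?T = "time_grid \<Delta>"
  have X': "is_process M ?T (\<lambda>t. X (- t))"
    using X by (auto simp: is_process_def intro: time_grid_uminus)
  have meas: "(\<lambda>\<omega>. \<lambda>t\<in>?T. Z t \<omega>) \<in> measurable M (\<Pi>\<^sub>M t\<in>?T. borel)"
    if "is_process M ?T Z" for Z :: "real \<Rightarrow> 'w \<Rightarrow> 'b"
    using that by (intro measurable_restrict) (auto simp: is_process_def)
  show "finite_measure (process_law M ?T (\<lambda>t. X (- t)))"
    unfolding process_law_def by (rule finite_measure_distr[OF meas[OF X']])
  fix A :: "real \<Rightarrow> 'b set" and J
  assume J: "finite J" "J \<subseteq> ?T" and A: "\<And>i. i \<in> J \<Longrightarrow> A i \<in> sets borel"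
  \<comment> \<open>Times of the window outside \<open>J\<close> receive \<open>UNIV\<close>, so
    that the window event is the cylinder event.\<close>
  define B where "B i = (if \<Delta> * of_int i \<in> J then A (\<Delta> * of_int i) else UNIV)" for i :: int
  have B: "B i \<in> sets borel" for i using A by (simp add: B_def)
  obtain I where I: "finite I" "J = (\<lambda>i. \<Delta> * of_int i) ` I"
    using finite_subset_image[OF J[unfolded time_grid_def]] by auto
  \<comment> \<open>The inserted 0 gives the maximum a nonempty set when \<open>J\<close> is
    empty.\<close>
  define m where "m = Max (insert 0 (abs ` I))"
  have m: "i \<in> {-m..m}" if "i \<in> I" for i
  proof -
    have "\<bar>i\<bar> \<le> m" unfolding m_def using I(1) that by (intro Max_ge) auto
    then show ?thesis by auto
  qed
  have cylinder: "emeasure (process_law M ?T Z) (prod_emb ?T (\<lambda>_. borel) J (Pi\<^sub>E J A))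
      = emeasure M {\<omega>\<in>space M. \<forall>i\<in>{-m..m}. Z (\<Delta> * of_int i) \<omega> \<in> B i}"
    if Z: "is_process M ?T Z" for Z
  proof -
    have "(\<forall>j\<in>J. Z j \<omega> \<in> A j) \<longleftrightarrow> (\<forall>i\<in>{-m..m}. Z (\<Delta> * of_int i) \<omega> \<in> B i)" for \<omega>
      using m I(2) by (auto simp: B_def)
    moreover have "(\<lambda>\<omega>. \<lambda>t\<in>?T. Z t \<omega>) -` prod_emb ?T (\<lambda>_. borel) J (Pi\<^sub>E J A) \<inter> space M
        = {\<omega>\<in>space M. \<forall>j\<in>J. Z j \<omega> \<in> A j}"
      using J(2) by (auto simp: prod_emb_def PiE_iff restrict_def extensional_def subset_eq split: if_splits)
    moreover have "prod_emb ?T (\<lambda>_. borel) J (Pi\<^sub>E J A) \<in> sets (\<Pi>\<^sub>M t\<in>?T. borel)"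
      using J A by (intro sets_PiM_I) auto
    ultimately show ?thesis
      unfolding process_law_def by (simp add: emeasure_distr[OF meas[OF Z]])
  qed
  show "emeasure (process_law M ?T (\<lambda>t. X (- t))) (prod_emb ?T (\<lambda>_. borel) J (Pi\<^sub>E J A))
      = emeasure (process_law M ?T X) (prod_emb ?T (\<lambda>_. borel) J (Pi\<^sub>E J A))"
    using cylinder[OF X] cylinder[OF X'] window[OF B, of m] by simp
qed (simp_all add: process_law_def)

theorem proposition2:
  fixes M :: "'w measure"
    and X :: "real \<Rightarrow> 'w \<Rightarrow> real ^ 'n"
    and \<Delta> t :: real
    and \<pi> :: "(real ^ 'n) measure"
  assumes "prob_space M"
    and "\<Delta> > 0"
    and "is_process M (time_grid \<Delta>) X"
    and "strictly_stationary M (time_grid \<Delta>) X"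
    and "\<forall>s\<in>time_grid \<Delta>. distr M borel (X s) = \<pi>"
    and "t \<in> time_grid \<Delta>"
  shows "(reversible M (time_grid \<Delta>) X \<longrightarrow>
            (\<forall>h\<in>time_grid \<Delta>. h \<ge> 0 \<longrightarrow>
               (\<forall>\<psi>\<in>L2_space \<pi>. \<forall>\<phi>\<in>L2_space \<pi>. feature_circulation M X t h \<psi> \<phi> = 0))) \<and>
         (markov_process M (time_grid \<Delta>) X \<longrightarrow>
            (\<forall>S. complete_system \<pi> S \<longrightarrow>
               (\<forall>\<psi>\<in>S. \<forall>\<phi>\<in>S. feature_circulation M X t \<Delta> \<psi> \<phi> = 0) \<longrightarrow>
               reversible M (time_grid \<Delta>) X))"
proof (intro conjI impI allI ballI)
  fix h \<psi> \<phi>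
  assume rev: "reversible M (time_grid \<Delta>) X" and h: "h \<in> time_grid \<Delta>"
    and L2: "\<psi> \<in> L2_space \<pi>" "\<phi> \<in> L2_space \<pi>"
  have "sets \<pi> = sets borel" using assms(5,6) by auto
  from measurable_cong_sets[OF this refl]
  have "\<psi> \<in> borel_measurable borel" "\<phi> \<in> borel_measurable borel"
    using L2 by (auto simp: L2_space_def)
  then show "feature_circulation M X t h \<psi> \<phi> = 0"
    by (rule reversible_feature_circulation[OF assms(3,4) rev assms(6) h])
next
  fix S
  assume markov: "markov_process M (time_grid \<Delta>) X" and S: "complete_system \<pi> S"
    and zero: "\<forall>\<psi>\<in>S. \<forall>\<phi>\<in>S. feature_circulation M X t \<Delta> \<psi> \<phi> = 0"
  let ?T = "time_grid \<Delta>"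
  have grid: "\<Delta> * of_int k \<in> ?T" for k by (auto simp: time_grid_def)
  have \<Delta>T: "\<Delta> \<in> ?T" using grid[of 1] by simp
  have t\<Delta>: "t + \<Delta> \<in> ?T" using assms(6) \<Delta>T by (rule time_grid_add)
  have meas: "X s \<in> borel_measurable M" if "s \<in> ?T" for s
    using assms(3) that by (simp add: is_process_def)
  \<comment> \<open>Counting grid steps by integers brings the process into the form of the locale,
    with \<open>F k\<close> generated by the grid times up to
    \<open>\<Delta> * of_int k\<close>.\<close>
  define Y where "Y k = X (\<Delta> * of_int k)" for k :: int
  have next_time: "Y (k + 1) = X (\<Delta> * of_int k + \<Delta>)" for k
    by (simp add: Y_def distrib_left)
  interpret symmetric_markov_chain M borel Y
    "\<lambda>k. generated_algebra M {r\<in>?T. r \<le> \<Delta> * of_int k} X"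
  proof (intro symmetric_markov_chain.intro symmetric_markov_chain_axioms.intro)
    show "prob_space M" by fact
    show "Y k \<in> borel_measurable M" for k unfolding Y_def by (rule meas[OF grid])
    show "subalgebra M (generated_algebra M {r\<in>?T. r \<le> \<Delta> * of_int k} X)" for k
      using meas by (intro subalgebra_generated_algebra) auto
    show "Y j \<in> borel_measurable (generated_algebra M {r\<in>?T. r \<le> \<Delta> * of_int k} X)"
      if "j \<le> k" for j k
      unfolding Y_def using that assms(2) grid by (intro measurable_generated_algebra) auto
    show "AE \<omega> in M.
        real_cond_exp M (generated_algebra M {r\<in>?T. r \<le> \<Delta> * of_int k} X) (\<lambda>\<omega>. indicator A (Y (k + 1) \<omega>)) \<omega>
      = real_cond_exp M (vimage_algebra (space M) (Y k) borel) (\<lambda>\<omega>. indicator A (Y (k + 1) \<omega>)) \<omega>"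
      if "A \<in> sets borel" for k A
    proof -
      \<comment> \<open>The Markov property is taken between the consecutive grid times
        \<open>\<Delta> * of_int k\<close> and
        \<open>\<Delta> * of_int k + \<Delta>\<close>.\<close>
      have "\<Delta> * of_int k \<le> \<Delta> * of_int k + \<Delta>" using assms(2) by simp
      with markov grid[of k] time_grid_add[OF grid[of k] \<Delta>T] that show ?thesis
        unfolding markov_process_def next_time unfolding Y_def generated_algebra_singleton[symmetric]
        by blast
    qed
    show "distr M (borel \<Otimes>\<^sub>M borel) (\<lambda>\<omega>. (Y k \<omega>, Y (k + 1) \<omega>))
        = distr M (borel \<Otimes>\<^sub>M borel) (\<lambda>\<omega>. (Y 0 \<omega>, Y 1 \<omega>))" for k
      using stationary_pair_law[OF assms(3,4) grid[of 0] grid[of 1] grid[of k]]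
      by (simp add: Y_def distrib_left add.commute)
    \<comment> \<open>The circulation is known to vanish at the base time \<open>t\<close>, so
      symmetry is obtained for the times \<open>t\<close> and \<open>t + \<Delta>\<close> and then
      carried to 0 and \<open>\<Delta>\<close> by stationarity, once for each order of the
      pair.\<close>
    have "distr M (borel \<Otimes>\<^sub>M borel) (\<lambda>\<omega>. (X (t + \<Delta>) \<omega>, X t \<omega>))
        = distr M (borel \<Otimes>\<^sub>M borel) (\<lambda>\<omega>. (X t \<omega>, X (t + \<Delta>) \<omega>))"
      by (rule pair_law_symmetricI[OF assms(1) _ _ _ _ S])
        (use meas assms(5,6) t\<Delta> zero in auto)
    then show "distr M (borel \<Otimes>\<^sub>M borel) (\<lambda>\<omega>. (Y 1 \<omega>, Y 0 \<omega>))
        = distr M (borel \<Otimes>\<^sub>M borel) (\<lambda>\<omega>. (Y 0 \<omega>, Y 1 \<omega>))"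
      using stationary_pair_law[OF assms(3,4) grid[of 0] grid[of 1] assms(6)]
        stationary_pair_law[OF assms(3,4) grid[of 1] grid[of 0] assms(6)]
      by (simp add: Y_def add.commute)
  qed
  show "reversible M ?T X"
    using window_reversible by (intro reversibleI_windows[OF assms(1-3)]) (simp add: Y_def)
qed

end
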